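(* Consider the piecewise linear system $$ \left\{\begin{array}{l}\dot x=T_Lx-y\\ \dot y=D_Lx-a_L\end{array}\right.\ \text{for } x<0,\qquad \left\{\begin{array}{l}\dot x=T_Rx-y+b\\ \dot y=D_Rx-a_R\end{array}\right.\ \text{for } x>0, $$ with $T_L,D_L,a_L,T_R,D_R,a_R,b\in\mathbb{R}$, $a_L^2+D_L^2\neq0$ and $a_R^2+D_R^2\neq0$, and let $I_L$ and $I_R$ be the domains of its forward and backward Poincaré half-maps $y_L$ and $y_R$. Assume that $T_L^2+T_R^2=0$. If $b\neq0$, then the system does not have crossing periodic orbits. If $b=0$ and $\operatorname{Int}(I_L\cap I_R)\neq\emptyset$, then it has a continuum of crossing periodic orbits.
   Context: Left Poincaré half-map of a linear system: for $T,D,a\in\mathbb{R}$ with $a^2+D^2\neq0$ (standing assumption) consider $\dot x=Tx-y$, $\dot y=Dx-a$ and $\Sigma=\{(x,y)\in\mathbb{R}^2:x=0\}$. For $y_0\geqslant0$ let $\Phi(t;y_0)=(\Phi_1(t;y_0),\Phi_2(t;y_0))$ be the solution with $\Phi(0;y_0)=(0,y_0)$. If there exists $\tau(y_0)>0$ such that $\Phi_1(\tau(y_0);y_0)=0$ and $\Phi_1(t;y_0)<0$ for every $t\in(0,\tau(y_0))$, put $P(y_0)=\Phi_2(\tau(y_0);y_0)\leqslant0$. If $P(0)$ is not defined by this rule, but for every $\varepsilon>0$ there exist $y_0\in(0,\varepsilon)$ and $y_1\in(-\varepsilon,0)$ with $P(y_0)=y_1$, then $P$ is extended by $P(0)=0$.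 Its domain is the interval $I\subset[0,+\infty)$ of all $y_0$ where $P$ is so defined. Half-maps of the piecewise system: the forward Poincaré half-map $y_L:I_L\subset[0,+\infty)\to(-\infty,0]$ is $y_L=P$ with $(T,D,a)=(T_L,D_L,a_L)$. The backward Poincaré half-map $y_R:I_R\subset[b,+\infty)\to(-\infty,b]$ maps $y_0\geqslant b$ to the point $(0,y_R(y_0))$ where the backward-time orbit of the right system starting at $(0,y_0)$ and running in $x>0$ returns to $\Sigma$; precisely, $y_R(y_0)=P(y_0-b)+b$ with $(T,D,a)=(-T_R,D_R,-a_R)$, with domain $I_R=b+I$. A crossing periodic orbit is a closed orbit formed by an arc of the left system contained in $x<0$ going from $(0,y_0)$ to $(0,y_1)$ and an arc of the right system contained in $x>0$ going from $(0,y_1)$ to $(0,y_0)$, where $y_0>\max\{0,b\}$ and $y_1<\min\{0,b\}$ (both vector fields cross $\Sigma$ transversally in the same direction at these points). Crossing periodic orbits are in bijective correspondence with the points $y_0\in\operatorname{Int}(I_L\cap I_R)$ such that $y_L(y_0)=y_R(y_0)$. *)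

theory Defs
  imports "HOL-Analysis.Analysis"
begin

text \<open>The half-systems on \<open>x < 0\<close> and \<open>x > 0\<close> of the piecewise linear system are
  \<open>lin_field T\<^sub>L D\<^sub>L a\<^sub>L 0\<close> and \<open>lin_field T\<^sub>R D\<^sub>R a\<^sub>R b\<close>.\<close>

definition lin_field :: "real \<Rightarrow> real \<Rightarrow> real \<Rightarrow> real \<Rightarrow> real \<times> real \<Rightarrow> real \<times> real" where
  "lin_field T D a b = (\<lambda>(x, y). (T * x - y + b, D * x - a))"

definition solution_on ::
    "(real \<times> real \<Rightarrow> real \<times> real) \<Rightarrow> (real \<Rightarrow> real \<times> real) \<Rightarrow> real set \<Rightarrow> bool" where
  "solution_on F \<phi> S \<longleftrightarrow> (\<forall>t\<in>S. (\<phi> has_vector_derivative F (\<phi> t)) (at t within S))"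

text \<open>The linear initial value problem has exactly one solution \<open>\<phi>\<close> on the whole line, and
  \<open>\<tau>\<close> is its first positive zero of \<open>x\<close>; hence \<open>y\<^sub>1\<close> below is unique whenever it exists.\<close>

definition first_return :: "real \<Rightarrow> real \<Rightarrow> real \<Rightarrow> real \<Rightarrow> real \<Rightarrow> bool" where
  "first_return T D a y\<^sub>0 y\<^sub>1 \<longleftrightarrow>
    (\<exists>\<phi> \<tau>. solution_on (lin_field T D a 0) \<phi> UNIV \<and> \<phi> 0 = (0, y\<^sub>0) \<and> \<tau> > 0 \<and>
      fst (\<phi> \<tau>) = 0 \<and> (\<forall>t\<in>{0<..<\<tau>}. fst (\<phi> t) < 0) \<and> y\<^sub>1 = snd (\<phi> \<tau>))"

text \<open>Half-maps are partial functions; their domains are given by \<^const>\<open>dom\<close>.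
  The second clause is the extension \<open>P 0 = 0\<close> by arbitrarily small half-turns.\<close>

definition left_half_map :: "real \<Rightarrow> real \<Rightarrow> real \<Rightarrow> real \<rightharpoonup> real" where
  "left_half_map T D a y\<^sub>0 =
    (if y\<^sub>0 \<ge> 0 \<and> (\<exists>y\<^sub>1. first_return T D a y\<^sub>0 y\<^sub>1)
     then Some (THE y\<^sub>1. first_return T D a y\<^sub>0 y\<^sub>1)
     else if y\<^sub>0 = 0 \<and>
       (\<forall>\<epsilon>>0. \<exists>u\<in>{0<..<\<epsilon>}. \<exists>v\<in>{-\<epsilon><..<0}. first_return T D a u v)
     then Some 0
     else None)"

definition forward_half_map :: "real \<Rightarrow> real \<Rightarrow> real \<Rightarrow> real \<rightharpoonup> real" where
  "forward_half_map T\<^sub>L D\<^sub>L a\<^sub>L = left_half_map T\<^sub>L D\<^sub>L a\<^sub>L"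

text \<open>The change \<open>(t, x, y) \<mapsto> (-t, -x, y - b)\<close> turns the right system in \<open>x > 0\<close> into the
  left one with parameters \<open>(-T\<^sub>R, D\<^sub>R, -a\<^sub>R)\<close>.\<close>

definition backward_half_map :: "real \<Rightarrow> real \<Rightarrow> real \<Rightarrow> real \<Rightarrow> real \<rightharpoonup> real" where
  "backward_half_map T\<^sub>R D\<^sub>R a\<^sub>R b y\<^sub>0 =
    map_option (\<lambda>y. y + b) (left_half_map (- T\<^sub>R) D\<^sub>R (- a\<^sub>R) (y\<^sub>0 - b))"

text \<open>\<open>A\<close> is an orbit arc of \<open>F\<close> from \<open>p\<close> to \<open>q\<close> (endpoints included) with all its
  interior points in \<open>H\<close>.\<close>

definition orbit_arc :: "(real \<times> real \<Rightarrow> real \<times> real) \<Rightarrow> (real \<times> real) set \<Rightarrow>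
    real \<times> real \<Rightarrow> real \<times> real \<Rightarrow> (real \<times> real) set \<Rightarrow> bool" where
  "orbit_arc F H p q A \<longleftrightarrow>
    (\<exists>\<phi> \<tau>. \<tau> > 0 \<and> solution_on F \<phi> {0..\<tau>} \<and> \<phi> 0 = p \<and> \<phi> \<tau> = q \<and>
      \<phi> ` {0<..<\<tau>} \<subseteq> H \<and> A = \<phi> ` {0..\<tau>})"

definition crossing_periodic_orbits ::
    "real \<Rightarrow> real \<Rightarrow> real \<Rightarrow> real \<Rightarrow> real \<Rightarrow> real \<Rightarrow> real \<Rightarrow> (real \<times> real) set set" where
  "crossing_periodic_orbits T\<^sub>L D\<^sub>L a\<^sub>L T\<^sub>R D\<^sub>R a\<^sub>R b =
    {\<Gamma>. \<exists>y\<^sub>0 y\<^sub>1 A B. y\<^sub>0 > max 0 b \<and> y\<^sub>1 < min 0 b \<and>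
      orbit_arc (lin_field T\<^sub>L D\<^sub>L a\<^sub>L 0) {p. fst p < 0} (0, y\<^sub>0) (0, y\<^sub>1) A \<and>
      orbit_arc (lin_field T\<^sub>R D\<^sub>R a\<^sub>R b) {p. fst p > 0} (0, y\<^sub>1) (0, y\<^sub>0) B \<and>
      \<Gamma> = A \<union> B}"

text \<open>A continuum of orbits is a one-parameter family of pairwise distinct members of \<open>\<O>\<close>,
  parametrised by the ordinates of crossing points with \<open>x = 0\<close> that fill a nondegenerate
  open interval.\<close>

definition has_continuum_of_orbits :: "(real \<times> real) set set \<Rightarrow> bool" where
  "has_continuum_of_orbits \<O> \<longleftrightarrow>
    (\<exists>u v \<Gamma>. u < v \<and> inj_on \<Gamma> {u<..<v} \<and> (\<forall>y\<in>{u<..<v}. \<Gamma> y \<in> \<O> \<and> (0, y) \<in> \<Gamma> y))"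

end

theory Submission
  imports Defs
begin

text \<open>Without trace each half-system is Hamiltonian, with energy \<open>(y - b)\<^sup>2 + D x\<^sup>2 - 2 a x\<close>, which
  on \<open>x = 0\<close> determines \<open>y\<close> up to reflection in \<open>b\<close>. A crossing periodic orbit would thus
  be invariant under reflection in both \<open>0\<close> and \<open>b\<close>, so \<open>b = 0\<close>; conversely, for \<open>b = 0\<close> both
  half-maps are \<open>y \<mapsto> -y\<close> and all half-orbits close up.\<close>

lemma solution_on_subset:
  assumes "solution_on F \<phi> S" "S' \<subseteq> S"
  shows "solution_on F \<phi> S'"
  using assms unfolding solution_on_def
  by (meson has_vector_derivative_within_subset subsetD)

lemma solution_on_trace_free_components:
  assumes "solution_on (lin_field 0 D a b) \<phi> S" "t \<in> S"
  shows "((\<lambda>t. fst (\<phi> t)) has_real_derivative b - snd (\<phi> t)) (at t within S)"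
    and "((\<lambda>t. snd (\<phi> t)) has_real_derivative D * fst (\<phi> t) - a) (at t within S)"
proof -
  have "(\<phi> has_vector_derivative (b - snd (\<phi> t), D * fst (\<phi> t) - a)) (at t within S)"
    using assms by (auto simp: solution_on_def lin_field_def case_prod_beta)
  from bounded_linear.has_vector_derivative[OF bounded_linear_fst this]
    bounded_linear.has_vector_derivative[OF bounded_linear_snd this]
  show "((\<lambda>t. fst (\<phi> t)) has_real_derivative b - snd (\<phi> t)) (at t within S)"
    and "((\<lambda>t. snd (\<phi> t)) has_real_derivative D * fst (\<phi> t) - a) (at t within S)"
    by (simp_all add: has_real_derivative_iff_has_vector_derivative)
qed

text \<open>Along solutions \<open>E\<close> has derivative
  \<open>2 (y - b) (D x - a) + (2 D x - 2 a) (b - y)\<close>, which vanishes identically. On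
  \<open>x = 0\<close> only the term \<open>(y - b)\<^sup>2\<close> survives. Convexity of
  \<open>S\<close> turns the zero derivative into constancy.\<close>

lemma trace_free_energy_conserved:
  assumes "solution_on (lin_field 0 D a b) \<phi> S" "convex S" "s \<in> S" "t \<in> S"
    and "fst (\<phi> s) = 0" "fst (\<phi> t) = 0"
  shows "(snd (\<phi> s) - b)\<^sup>2 = (snd (\<phi> t) - b)\<^sup>2"
proof -
  define E where "E = (\<lambda>t. (snd (\<phi> t) - b)\<^sup>2 + D * (fst (\<phi> t))\<^sup>2 - 2 * a * fst (\<phi> t))"
  have "(E has_real_derivative 0) (at u within S)" if "u \<in> S" for u
    unfolding E_def
    by (rule derivative_eq_intros solution_on_trace_free_components[OF assms(1) that] refl)+
      (simp add: algebra_simps)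
  then obtain c where "\<And>u. u \<in> S \<Longrightarrow> E u = c"
    using has_field_derivative_zero_constant[OF assms(2)] by blast
  then have "E s = E t" using assms(3,4) by simp
  then show ?thesis using assms(5,6) by (simp add: E_def)
qed

text \<open>Equal energies leave \<open>y = z\<close> or \<open>y + z = 2 * b\<close>; endpoints
  strictly on opposite sides of \<open>b\<close> exclude the former.\<close>

lemma orbit_arc_trace_free_reflection:
  assumes "orbit_arc (lin_field 0 D a b) H (0, y) (0, z) A"
    and "y < b \<and> b < z \<or> z < b \<and> b < y"
  shows "y + z = 2 * b"
proof -
  obtain \<phi> \<tau> where "\<tau> > 0" "solution_on (lin_field 0 D a b) \<phi> {0..\<tau>}"
    "\<phi> 0 = (0, y)" "\<phi> \<tau> = (0, z)"
    using assms(1) by (auto simp: orbit_arc_def)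
  then have "(y - b)\<^sup>2 = (z - b)\<^sup>2"
    using trace_free_energy_conserved[of D a b \<phi> "{0..\<tau>}" 0 \<tau>] by simp
  then show ?thesis using assms(2) by (auto simp: power2_eq_iff)
qed

text \<open>Interior points of the arc lie in \<open>H\<close>, off the axis. This later tells
  closed orbits apart by where they cross \<open>x = 0\<close>.\<close>

lemma orbit_arc_axis_points:
  assumes "orbit_arc F H p q A" "\<And>r. r \<in> H \<Longrightarrow> fst r \<noteq> 0" "(0, z) \<in> A"
  shows "(0, z) = p \<or> (0, z) = q"
proof -
  obtain \<phi> \<tau> where "\<tau> > 0 \<and> solution_on F \<phi> {0..\<tau>} \<and> \<phi> 0 = p \<and> \<phi> \<tau> = q \<and>
      \<phi> ` {0<..<\<tau>} \<subseteq> H \<and> A = \<phi> ` {0..\<tau>}"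
    using assms(1) unfolding orbit_arc_def by (elim exE) (rule that)
  then have \<phi>: "\<phi> 0 = p" "\<phi> \<tau> = q" "\<phi> ` {0<..<\<tau>} \<subseteq> H" "A = \<phi> ` {0..\<tau>}"
    by simp_all
  obtain t where t: "0 \<le> t" "t \<le> \<tau>" "\<phi> t = (0, z)"
    using assms(3) \<phi>(4) by auto
  have "\<not> (0 < t \<and> t < \<tau>)"
    using assms(2)[of "\<phi> t"] subsetD[OF \<phi>(3) imageI[of t]] t(3) by auto
  then have "t = 0 \<or> t = \<tau>" using t(1,2) by linarith
  then show ?thesis using t(3) \<phi>(1,2) by auto
qed

lemma orbit_arc_endpoints:
  assumes "orbit_arc F H p q A"
  shows "p \<in> A" "q \<in> A"
  using assms by (force simp: orbit_arc_def)+

text \<open>Energy gives \<open>z = y\<close> or \<open>z = - y\<close>. The sign is decided by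
  direction: the axis is reached from \<open>x < 0\<close>, so the velocity \<open>- z\<close> of
  \<open>x\<close> at time \<open>\<tau>\<close> cannot be negative.\<close>

lemma first_return_trace_free:
  assumes "first_return 0 D a y z" "y > 0"
  shows "z = - y"
proof -
  obtain \<phi> \<tau> where \<phi>: "solution_on (lin_field 0 D a 0) \<phi> UNIV" "\<phi> 0 = (0, y)" "\<tau> > 0"
    "fst (\<phi> \<tau>) = 0" "\<And>t. t \<in> {0<..<\<tau>} \<Longrightarrow> fst (\<phi> t) < 0" "z = snd (\<phi> \<tau>)"
    using assms(1) by (auto simp: first_return_def)
  have "y\<^sup>2 = z\<^sup>2"
    using trace_free_energy_conserved[OF \<phi>(1), of 0 \<tau>] \<phi> by simp
  moreover have "z \<le> 0"
  proof (rule ccontr)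
    assume "\<not> z \<le> 0"
    moreover have "((\<lambda>t. fst (\<phi> t)) has_real_derivative - z) (at \<tau>)"
      using solution_on_trace_free_components(1)[OF \<phi>(1), of \<tau>] \<phi>(6) by simp
    ultimately obtain d where d: "d > 0" "\<And>h. 0 < h \<Longrightarrow> h < d \<Longrightarrow> fst (\<phi> \<tau>) < fst (\<phi> (\<tau> - h))"
      using DERIV_neg_dec_left[of "\<lambda>t. fst (\<phi> t)" "- z" \<tau>] by auto
    \<comment> \<open>Halving keeps \<open>\<tau> - h\<close> inside the open interval where
      \<open>x < 0\<close>, yet close enough to \<open>\<tau>\<close> for the negative derivative to
      force \<open>x > 0\<close> there.\<close>
    define h where "h = min d \<tau> / 2"
    have "0 < h" "h < d" "h < \<tau>" using d(1) \<phi>(3) by (auto simp: h_def)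
    then show False using d(2)[of h] \<phi>(4) \<phi>(5)[of "\<tau> - h"] by auto
  qed
  ultimately show ?thesis using assms(2) by (auto simp: power2_eq_iff)
qed

lemma first_return_orbit_arc:
  assumes "first_return T D a y z"
  shows "\<exists>A. orbit_arc (lin_field T D a 0) {p. fst p < 0} (0, y) (0, z) A"
proof -
  obtain \<phi> \<tau> where \<phi>: "solution_on (lin_field T D a 0) \<phi> UNIV" "\<phi> 0 = (0, y)" "\<tau> > 0"
    "fst (\<phi> \<tau>) = 0" "\<And>t. t \<in> {0<..<\<tau>} \<Longrightarrow> fst (\<phi> t) < 0" "z = snd (\<phi> \<tau>)"
    using assms by (auto simp: first_return_def)
  have "\<phi> \<tau> = (0, z)" using \<phi>(4,6) by (simp add: prod_eq_iff)
  then show ?thesis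
    unfolding orbit_arc_def
    using \<phi>(2,3,5) solution_on_subset[OF \<phi>(1), of "{0..\<tau>}"] by blast
qed

text \<open>This undoes the change of variables \<open>(t, x, y) \<mapsto> (-t, -x, y - b)\<close>
  behind \<open>backward_half_map\<close>, so that its half-turns become genuine forward arcs of the
  right system.\<close>

lemma orbit_arc_reverse:
  assumes "orbit_arc (lin_field (- T) D (- a) 0) {p. fst p < 0} (0, y) (0, z) A"
  shows "\<exists>B. orbit_arc (lin_field T D a b) {p. fst p > 0} (0, z + b) (0, y + b) B"
proof -
  obtain \<phi> \<tau> where \<phi>: "solution_on (lin_field (- T) D (- a) 0) \<phi> {0..\<tau>}" "\<tau> > 0"
    "\<phi> 0 = (0, y)" "\<phi> \<tau> = (0, z)" "\<phi> ` {0<..<\<tau>} \<subseteq> {p. fst p < 0}"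
    using assms by (auto simp: orbit_arc_def)
  \<comment> \<open>Time runs as \<open>\<tau> - t\<close> rather than \<open>-t\<close>, so that
    the reversed arc is again parametrised by \<open>{0..\<tau>}\<close>, with its endpoints
    exchanged.\<close>
  define \<psi> where "\<psi> = (\<lambda>t. (- fst (\<phi> (\<tau> - t)), snd (\<phi> (\<tau> - t)) + b))"
  have "(\<psi> has_vector_derivative lin_field T D a b (\<psi> t)) (at t within {0..\<tau>})"
    if t: "t \<in> {0..\<tau>}" for t
  proof -
    \<comment> \<open>The reflection maps the interval onto itself, so the chain rule within sets
      also covers the one-sided derivatives at both ends.\<close>
    have img: "(\<lambda>t. \<tau> - t) ` {0..\<tau>} = {0..\<tau>}" by simp
    have "(\<phi> has_vector_derivative lin_field (- T) D (- a) 0 (\<phi> (\<tau> - t)))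
        (at (\<tau> - t) within (\<lambda>t. \<tau> - t) ` {0..\<tau>})"
      unfolding img using \<phi>(1) t by (simp add: solution_on_def)
    moreover have "((\<lambda>t. \<tau> - t) has_vector_derivative - 1) (at t within {0..\<tau>})"
      by (auto intro!: derivative_eq_intros)
    ultimately have "((\<lambda>t. \<phi> (\<tau> - t)) has_vector_derivative
        - lin_field (- T) D (- a) 0 (\<phi> (\<tau> - t))) (at t within {0..\<tau>})"
      using vector_diff_chain_within[of "\<lambda>t. \<tau> - t" "- 1" t "{0..\<tau>}" \<phi>] by (simp add: o_def)
    \<comment> \<open>The minus sign from time reversal cancels against \<open>-x\<close> in the
      first component and remains in the second, which yields the parameters \<open>T\<close> and
      \<open>a\<close>.\<close>
    from bounded_linear.has_vector_derivative[OF bounded_linear_fst this]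
      bounded_linear.has_vector_derivative[OF bounded_linear_snd this]
    show ?thesis
      unfolding \<psi>_def
      by (auto intro!: derivative_eq_intros simp: lin_field_def case_prod_beta)
  qed
  then have "solution_on (lin_field T D a b) \<psi> {0..\<tau>}"
    by (simp add: solution_on_def)
  moreover have "\<psi> 0 = (0, z + b)" "\<psi> \<tau> = (0, y + b)"
    using \<phi>(3,4) by (simp_all add: \<psi>_def)
  moreover have "\<psi> ` {0<..<\<tau>} \<subseteq> {p. fst p > 0}"
  proof (clarsimp simp: \<psi>_def)
    fix t assume "0 < t" "t < \<tau>"
    then have "\<phi> (\<tau> - t) \<in> {p. fst p < 0}"
      using \<phi>(5) by (intro subsetD[OF \<phi>(5)] imageI) auto
    then show "fst (\<phi> (\<tau> - t)) < 0" by simp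
  qed
  ultimately show ?thesis
    using \<phi>(2) by (auto simp: orbit_arc_def)
qed

text \<open>At \<open>y = 0\<close> membership may come from the extension \<open>P 0 = 0\<close>
  instead of an actual return, hence the strict inequality in the second claim.\<close>

lemma dom_left_half_map:
  assumes "y \<in> dom (left_half_map T D a)"
  shows "y \<ge> 0" and "y > 0 \<Longrightarrow> \<exists>z. first_return T D a y z"
  using assms by (auto simp: left_half_map_def split: if_splits)

lemma dom_backward_half_map:
  "dom (backward_half_map T D a b) = {y. y - b \<in> dom (left_half_map (- T) D (- a))}"
  by (auto simp: backward_half_map_def)

text \<open>Both half-turns from \<open>y\<close> end at \<open>- y\<close>, so the two arcs close
  up. The last conjunct makes \<open>y\<close> recoverable from the orbit, which gives distinct
  orbits for distinct \<open>y\<close>.\<close>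

lemma trace_free_orbit_through:
  assumes "y > 0" "y \<in> dom (forward_half_map 0 D\<^sub>L a\<^sub>L)" "y \<in> dom (backward_half_map 0 D\<^sub>R a\<^sub>R 0)"
  shows "\<exists>\<Gamma>. \<Gamma> \<in> crossing_periodic_orbits 0 D\<^sub>L a\<^sub>L 0 D\<^sub>R a\<^sub>R 0 \<and> (0, y) \<in> \<Gamma> \<and>
    (\<forall>z>0. (0, z) \<in> \<Gamma> \<longrightarrow> z = y)"
proof -
  have "first_return 0 D\<^sub>L a\<^sub>L y (- y)"
    using dom_left_half_map(2)[of y 0 D\<^sub>L a\<^sub>L] first_return_trace_free assms(1,2)
    unfolding forward_half_map_def by blast
  then obtain A where A: "orbit_arc (lin_field 0 D\<^sub>L a\<^sub>L 0) {p. fst p < 0} (0, y) (0, - y) A"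
    using first_return_orbit_arc by blast
  have "first_return 0 D\<^sub>R (- a\<^sub>R) y (- y)"
    using dom_left_half_map(2)[of y 0 D\<^sub>R "- a\<^sub>R"] first_return_trace_free assms(1,3)
    by (auto simp: dom_backward_half_map)
  then obtain B where B: "orbit_arc (lin_field 0 D\<^sub>R a\<^sub>R 0) {p. fst p > 0} (0, - y) (0, y) B"
    using first_return_orbit_arc orbit_arc_reverse[of 0 D\<^sub>R a\<^sub>R y "- y" _ 0] by fastforce
  have "A \<union> B \<in> crossing_periodic_orbits 0 D\<^sub>L a\<^sub>L 0 D\<^sub>R a\<^sub>R 0"
    unfolding crossing_periodic_orbits_def mem_Collect_eq
    using A B assms(1) by (intro exI[of _ y] exI[of _ "- y"] exI[of _ A] exI[of _ B]) auto
  moreover have "z = y" if "z > 0" "(0, z) \<in> A \<union> B" for z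
    using that assms(1) orbit_arc_axis_points[OF A, of z] orbit_arc_axis_points[OF B, of z] by auto
  ultimately show ?thesis
    using orbit_arc_endpoints(1)[OF A] by (intro exI[of _ "A \<union> B"]) simp
qed

theorem corollary2:
  fixes T\<^sub>L D\<^sub>L a\<^sub>L T\<^sub>R D\<^sub>R a\<^sub>R b :: real
  assumes "a\<^sub>L\<^sup>2 + D\<^sub>L\<^sup>2 \<noteq> 0"
    and "a\<^sub>R\<^sup>2 + D\<^sub>R\<^sup>2 \<noteq> 0"
    and "T\<^sub>L\<^sup>2 + T\<^sub>R\<^sup>2 = 0"
  shows "(b \<noteq> 0 \<longrightarrow> crossing_periodic_orbits T\<^sub>L D\<^sub>L a\<^sub>L T\<^sub>R D\<^sub>R a\<^sub>R b = {}) \<and>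
    (b = 0 \<and>
      interior (dom (forward_half_map T\<^sub>L D\<^sub>L a\<^sub>L) \<inter> dom (backward_half_map T\<^sub>R D\<^sub>R a\<^sub>R b)) \<noteq> {}
      \<longrightarrow> has_continuum_of_orbits (crossing_periodic_orbits T\<^sub>L D\<^sub>L a\<^sub>L T\<^sub>R D\<^sub>R a\<^sub>R b))"
proof (intro conjI impI)
  have T: "T\<^sub>L = 0" "T\<^sub>R = 0" using assms(3) by (simp_all add: sum_power2_eq_zero_iff)
  show "crossing_periodic_orbits T\<^sub>L D\<^sub>L a\<^sub>L T\<^sub>R D\<^sub>R a\<^sub>R b = {}" if "b \<noteq> 0"
  proof (rule ccontr)
    assume "crossing_periodic_orbits T\<^sub>L D\<^sub>L a\<^sub>L T\<^sub>R D\<^sub>R a\<^sub>R b \<noteq> {}"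
    then obtain y\<^sub>0 y\<^sub>1 A B where y: "y\<^sub>0 > max 0 b" "y\<^sub>1 < min 0 b"
      and A: "orbit_arc (lin_field 0 D\<^sub>L a\<^sub>L 0) {p. fst p < 0} (0, y\<^sub>0) (0, y\<^sub>1) A"
      and B: "orbit_arc (lin_field 0 D\<^sub>R a\<^sub>R b) {p. fst p > 0} (0, y\<^sub>1) (0, y\<^sub>0) B"
      unfolding crossing_periodic_orbits_def T by blast
    \<comment> \<open>The crossing inequalities put the endpoints strictly on opposite sides of both
      centres, \<open>0\<close> for the left arc and \<open>b\<close> for the right one.\<close>
    have "y\<^sub>0 + y\<^sub>1 = 2 * 0" "y\<^sub>1 + y\<^sub>0 = 2 * b"
      using orbit_arc_trace_free_reflection[OF A] orbit_arc_trace_free_reflection[OF B] y by auto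
    then show False using that by simp
  qed
  show "has_continuum_of_orbits (crossing_periodic_orbits T\<^sub>L D\<^sub>L a\<^sub>L T\<^sub>R D\<^sub>R a\<^sub>R b)"
    if h: "b = 0 \<and>
      interior (dom (forward_half_map T\<^sub>L D\<^sub>L a\<^sub>L) \<inter> dom (backward_half_map T\<^sub>R D\<^sub>R a\<^sub>R b)) \<noteq> {}"
  proof -
    let ?I = "dom (forward_half_map 0 D\<^sub>L a\<^sub>L) \<inter> dom (backward_half_map 0 D\<^sub>R a\<^sub>R 0)"
    have "interior ?I \<noteq> {}" using conjunct2[OF h] unfolding T conjunct1[OF h] .
    then obtain c e where ce: "e > 0" "ball c e \<subseteq> ?I"
      by (meson ex_in_conv mem_interior)
    have "c \<in> ?I" using subsetD[OF ce(2)] ce(1) centre_in_ball by blast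
    then have "c \<ge> 0"
      unfolding forward_half_map_def by (rule dom_left_half_map(1)[OF IntD1])
    \<comment> \<open>Taking only the half of the ball to the right of \<open>c\<close> turns
      \<open>c \<ge> 0\<close> into \<open>y > 0\<close>, which keeps clear of the extended value at
      \<open>0\<close>.\<close>
    have "\<exists>\<Gamma>. \<Gamma> \<in> crossing_periodic_orbits 0 D\<^sub>L a\<^sub>L 0 D\<^sub>R a\<^sub>R 0 \<and> (0, y) \<in> \<Gamma> \<and>
        (\<forall>z>0. (0, z) \<in> \<Gamma> \<longrightarrow> z = y)" if "y \<in> {c<..<c + e}" for y
    proof -
      have "y \<in> ball c e" using that by (auto simp: dist_real_def)
      then show ?thesis
        using ce(2) that \<open>c \<ge> 0\<close> by (intro trace_free_orbit_through) auto
    qed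
    then have "\<forall>y\<in>{c<..<c + e}. \<exists>\<Gamma>. \<Gamma> \<in> crossing_periodic_orbits 0 D\<^sub>L a\<^sub>L 0 D\<^sub>R a\<^sub>R 0 \<and>
        (0, y) \<in> \<Gamma> \<and> (\<forall>z>0. (0, z) \<in> \<Gamma> \<longrightarrow> z = y)"
      by (intro ballI)
    from bchoice[OF this] obtain \<Gamma> where \<Gamma>: "\<forall>y\<in>{c<..<c + e}.
        \<Gamma> y \<in> crossing_periodic_orbits 0 D\<^sub>L a\<^sub>L 0 D\<^sub>R a\<^sub>R 0 \<and> (0, y) \<in> \<Gamma> y \<and>
        (\<forall>z>0. (0, z) \<in> \<Gamma> y \<longrightarrow> z = y)" ..
    \<comment> \<open>If two orbits of the family coincide, the positive crossing ordinate
      \<open>x\<close> of one also lies on the other, whose only positive one is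
      \<open>y\<close>.\<close>
    have "inj_on \<Gamma> {c<..<c + e}"
    proof (rule inj_onI)
      fix x y assume xy: "x \<in> {c<..<c + e}" "y \<in> {c<..<c + e}" "\<Gamma> x = \<Gamma> y"
      have "x > 0" using xy(1) \<open>c \<ge> 0\<close> by simp
      moreover have "(0, x) \<in> \<Gamma> y" using bspec[OF \<Gamma> xy(1)] unfolding xy(3) by (elim conjE)
      ultimately show "x = y" using bspec[OF \<Gamma> xy(2)] by blast
    qed
    moreover have "\<forall>y\<in>{c<..<c + e}.
        \<Gamma> y \<in> crossing_periodic_orbits 0 D\<^sub>L a\<^sub>L 0 D\<^sub>R a\<^sub>R 0 \<and> (0, y) \<in> \<Gamma> y"
      using \<Gamma> by blast
    moreover have "c < c + e" using ce(1) by simp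
    ultimately show ?thesis
      unfolding has_continuum_of_orbits_def T conjunct1[OF h] by (intro exI conjI)
  qed
qed

end
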